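(* Let $G$ be a locally $\sigma$-compact rectifiable space with a $bc$-base. Then $G$ is locally compact or $G$ is zero-dimensional.
   Context: All spaces are assumed to be Hausdorff. A topological space $G$ is a rectifiable space if there are a surjective homeomorphism $\varphi: G\times G\rightarrow G\times G$ and an element $e\in G$ such that $\pi_1\circ\varphi=\pi_1$ and $\varphi(x,x)=(x,e)$ for every $x\in G$, where $\pi_1: G\times G\rightarrow G$ is the projection to the first coordinate. A space $X$ is locally compact (resp. locally $\sigma$-compact) if each $x\in X$ has a neighborhood $U$ in $X$ whose closure in $X$ is compact (resp. $\sigma$-compact, i.e. a countable union of compact subsets). A base $\mathscr{B}$ of open sets of a space $X$ is a $bc$-base if the boundary $\overline{U}\setminus U$ of every member $U$ of $\mathscr{B}$ is compact. A space is zero-dimensional if it has a base consisting of clopen sets. *)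

theory Defs
  imports "HOL-Analysis.Analysis"
begin

definition rectifiable_space :: "'a topology \<Rightarrow> bool" where
  "rectifiable_space G \<longleftrightarrow>
     (\<exists>\<phi> e. homeomorphic_map (prod_topology G G) (prod_topology G G) \<phi> \<and>
            e \<in> topspace G \<and>
            (\<forall>p \<in> topspace (prod_topology G G). fst (\<phi> p) = fst p) \<and>
            (\<forall>x \<in> topspace G. \<phi> (x, x) = (x, e)))"

definition sigma_compactin :: "'a topology \<Rightarrow> 'a set \<Rightarrow> bool" where
  "sigma_compactin X S \<longleftrightarrow>
     (\<exists>\<K>. countable \<K> \<and> (\<forall>K \<in> \<K>. compactin X K) \<and> S = \<Union>\<K>)"

text \<open>Neighbourhoods are not required to be open.\<close>

definition locally_sigma_compact_space :: "'a topology \<Rightarrow> bool" where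
  "locally_sigma_compact_space X \<longleftrightarrow>
     (\<forall>x \<in> topspace X. \<exists>N \<subseteq> topspace X.
        x \<in> X interior_of N \<and> sigma_compactin X (X closure_of N))"

text \<open>The library's \<^const>\<open>locally_compact_space\<close> asks for an open neighbourhood contained in a
  compact set. In Hausdorff spaces this agrees with asking for a neighbourhood with compact closure.\<close>

lemma locally_compact_space_iff_compact_closure:
  assumes "Hausdorff_space X"
  shows "locally_compact_space X \<longleftrightarrow>
    (\<forall>x \<in> topspace X. \<exists>N \<subseteq> topspace X.
       x \<in> X interior_of N \<and> compactin X (X closure_of N))" (is "?L \<longleftrightarrow> ?R")
proof
  assume ?L
  show ?R
  proof
    fix x assume "x \<in> topspace X"
    then obtain U K where UK: "openin X U" "compactin X K" "x \<in> U" "U \<subseteq> K"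
      using \<open>?L\<close> unfolding locally_compact_space_def by blast
    have "closedin X K"
      using assms UK(2) compactin_imp_closedin by blast
    then have "X closure_of U \<subseteq> K"
      by (simp add: UK(4) closure_of_minimal)
    then have "compactin X (X closure_of U)"
      using UK(2) closed_compactin closedin_closure_of by blast
    moreover have "X interior_of U = U" "U \<subseteq> topspace X"
      using UK(1) by (simp_all add: interior_of_openin openin_subset)
    ultimately show "\<exists>N \<subseteq> topspace X. x \<in> X interior_of N \<and> compactin X (X closure_of N)"
      using UK(3) by blast
  qed
next
  assume ?R
  show ?L
    unfolding locally_compact_space_def
  proof
    fix x assume "x \<in> topspace X"
    then obtain N where N: "N \<subseteq> topspace X" "x \<in> X interior_of N" "compactin X (X closure_of N)"
      using \<open>?R\<close> by blast
    have "X interior_of N \<subseteq> X closure_of N"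
      by (rule interior_of_subset_closure_of)
    then show "\<exists>U K. openin X U \<and> compactin X K \<and> x \<in> U \<and> U \<subseteq> K"
      using N openin_interior_of by blast
  qed
qed

definition open_base :: "'a topology \<Rightarrow> 'a set set \<Rightarrow> bool" where
  "open_base X \<B> \<longleftrightarrow>
     (\<forall>B \<in> \<B>. openin X B) \<and>
     (\<forall>U x. openin X U \<and> x \<in> U \<longrightarrow> (\<exists>B \<in> \<B>. x \<in> B \<and> B \<subseteq> U))"

definition bc_base :: "'a topology \<Rightarrow> 'a set set \<Rightarrow> bool" where
  "bc_base X \<B> \<longleftrightarrow> open_base X \<B> \<and> (\<forall>U \<in> \<B>. compactin X (X closure_of U - U))"

definition zero_dimensional_space :: "'a topology \<Rightarrow> bool" where
  "zero_dimensional_space X \<longleftrightarrow> (\<exists>\<B>. open_base X \<B> \<and> (\<forall>U \<in> \<B>. closedin X U))"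

end

theory Submission
  imports Defs
begin

text \<open>Write \<open>\<phi> (x, y) = (x, q x y)\<close> and \<open>\<phi>\<inverse> (x, y) = (x, p x y)\<close>, so that \<open>p x e = x\<close>. Let \<open>K\<close> be
  compact and connected with two distinct points \<open>a\<close>, \<open>b\<close>, and let \<open>U\<close> be a member of the
  \<open>bc\<close>-base with \<open>a \<in> U\<close> and \<open>b \<notin> closure U\<close>. For \<open>z\<close> near \<open>e\<close>, the connected set
  \<open>{p k z | k. k \<in> K}\<close> still meets \<open>U\<close> and the exterior of \<open>U\<close>, hence contains a point \<open>p k z\<close> of the
  compact boundary \<open>B\<close> of \<open>U\<close>; then \<open>z = q k (p k z)\<close> lies in the compact set \<open>q K B\<close>. So \<open>G\<close> is
  locally compact at \<open>e\<close>, and by homogeneity everywhere. Otherwise all compact subsets of \<open>G\<close> are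
  totally disconnected, and the countable sum theorem for large inductive dimension zero, applied to
  the \<open>\<sigma>\<close>-compact closures of small members of the base, produces clopen neighbourhoods.\<close>

section \<open>Regularity from compact boundaries\<close>

text \<open>The Hausdorff property separates \<open>a\<close> from the compact boundary of a base
  member \<open>B\<close> that avoids \<open>C\<close>. Shrinking \<open>B\<close> by the resulting
  \<open>U\<close> gives a neighbourhood whose closure misses that boundary and so stays inside
  \<open>B\<close>.\<close>

lemma bc_base_imp_regular_space:
  assumes "Hausdorff_space X" "bc_base X \<B>"
  shows "regular_space X"
  unfolding regular_space
proof (intro allI impI)
  fix C a assume "closedin X C \<and> a \<in> topspace X - C"
  then have C: "closedin X C" and a: "a \<in> topspace X" "a \<notin> C"
    by auto
  have "openin X (topspace X - C)"
    using C by blast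
  then obtain B where B: "B \<in> \<B>" "a \<in> B" "B \<subseteq> topspace X - C"
    using assms(2) a unfolding bc_base_def open_base_def by (metis DiffI)
  have oB: "openin X B" and cB: "compactin X (X closure_of B - B)"
    using assms(2) B(1) unfolding bc_base_def open_base_def by auto
  have "compactin X {a}" "disjnt {a} (X closure_of B - B)"
    using a B(2) by auto
  then obtain U V where UV: "openin X U" "openin X V" "{a} \<subseteq> U" "X closure_of B - B \<subseteq> V" "disjnt U V"
    using Hausdorff_space_compact_separation[OF assms(1) _ cB] by metis
  have "X closure_of (U \<inter> B) \<subseteq> topspace X - V"
    using UV openin_subset[OF UV(1)] by (intro closure_of_minimal) (auto simp: disjnt_iff)
  moreover have "X closure_of (U \<inter> B) \<subseteq> X closure_of B"
    by (simp add: closure_of_mono)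
  ultimately have "X closure_of (U \<inter> B) \<subseteq> B"
    using UV(4) by blast
  then have "disjnt C (X closure_of (U \<inter> B))"
    using B(3) by (auto simp: disjnt_iff)
  then show "\<exists>U. openin X U \<and> a \<in> U \<and> disjnt C (X closure_of U)"
    using UV(1,3) oB B(2) by (intro exI[of _ "U \<inter> B"]) auto
qed

section \<open>Clopen separation of disjoint closed sets: compact pieces and countable sums\<close>

text \<open>In a compact Hausdorff space a component can be split off by a clopen partition from any
  closed set disjoint from it. Here components are points, and compactness of \<open>S\<close>
  passes from its points to all of \<open>S\<close>.\<close>

lemma separated_between_compact_totally_disconnected:
  assumes X: "compact_space X" "Hausdorff_space X"
    and td: "\<And>C a b. connectedin X C \<Longrightarrow> a \<in> C \<Longrightarrow> b \<in> C \<Longrightarrow> a = b"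
    and ST: "closedin X S" "closedin X T" "disjnt S T"
  shows "separated_between X S T"
proof -
  have "separated_between X {x} T" if "x \<in> S" for x
  proof -
    have x: "x \<in> topspace X"
      using that ST(1) closedin_subset by blast
    have "connected_component_of_set X x = {x}"
      using td[OF connectedin_connected_component_of[of X x]] x
      by (auto simp: connected_component_of_refl)
    then have "{x} \<in> connected_components_of X"
      using x by (metis connected_component_in_connected_components_of)
    then show ?thesis
      using X ST that x compact_imp_locally_compact_space
      by (intro separated_between_compact_connected_component) (auto simp: disjnt_iff)
  qed
  moreover have "compactin X S"
    using X(1) ST(1) closedin_compact_space by blast
  ultimately show ?thesis
    using separated_between_pointwise_left closedin_subset[OF ST(2)] by blast
qed

text \<open>One stage of the countable sum theorem: \<open>K\<close> is split between the two sets,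
  which are also thickened. Containment in the interiors is what makes the unions over all stages
  open.\<close>

lemma normal_space_separated_between_enlarge:
  assumes X: "normal_space X" and K: "closedin X K"
    and sep: "\<And>S T. closedin X S \<Longrightarrow> closedin X T \<Longrightarrow> disjnt S T \<Longrightarrow>
                separated_between (subtopology X K) (K \<inter> S) (K \<inter> T)"
    and AB: "closedin X A" "closedin X B" "disjnt A B"
  obtains A' B' where "closedin X A'" "closedin X B'" "disjnt A' B'"
    "A \<subseteq> X interior_of A'" "B \<subseteq> X interior_of B'" "K \<subseteq> A' \<union> B'"
proof -
  have "separated_between (subtopology X K) (K \<inter> A) (K \<inter> B)"
    using sep AB by blast
  then obtain C D where CD: "closedin (subtopology X K) C" "closedin (subtopology X K) D"
    "C \<union> D = topspace X \<inter> K" "disjnt C D" "K \<inter> A \<subseteq> C" "K \<inter> B \<subseteq> D"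
    unfolding separated_between_alt by auto
  have cl: "closedin X (A \<union> C)" "closedin X (B \<union> D)"
    using CD(1,2) AB K closedin_trans_full by blast+
  \<comment> \<open>A point of \<open>B\<close> in \<open>C\<close> lies in \<open>K\<close>, hence
    in \<open>D\<close>, which is disjoint from \<open>C\<close>; likewise for \<open>A\<close> and
    \<open>D\<close>.\<close>
  have "disjnt (A \<union> C) (B \<union> D)"
    using AB(3) CD(3-6) by (fastforce simp: disjnt_iff)
  \<comment> \<open>Normality is applied twice, so that even the closures of \<open>U\<close> and
    \<open>V\<close> are disjoint; these closures serve as \<open>A'\<close> and
    \<open>B'\<close>.\<close>
  then obtain U where U: "openin X U" "A \<union> C \<subseteq> U" "disjnt (B \<union> D) (X closure_of U)"
    using X cl unfolding normal_space by meson
  then obtain V where V: "openin X V" "B \<union> D \<subseteq> V" "disjnt (X closure_of U) (X closure_of V)"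
    using X cl(2) closedin_closure_of[of X U] unfolding normal_space by meson
  have "U \<subseteq> X interior_of (X closure_of U)" "V \<subseteq> X interior_of (X closure_of V)"
    using U(1) V(1) by (simp_all add: closure_of_subset interior_of_maximal openin_subset)
  moreover have "U \<subseteq> X closure_of U" "V \<subseteq> X closure_of V"
    using U(1) V(1) by (simp_all add: closure_of_subset openin_subset)
  moreover have "K \<subseteq> C \<union> D"
    using CD(3) closedin_subset[OF K] by blast
  ultimately have "A \<subseteq> X interior_of (X closure_of U)" "B \<subseteq> X interior_of (X closure_of V)"
    "K \<subseteq> X closure_of U \<union> X closure_of V"
    using U(2) V(2) by blast+
  then show thesis
    using that V(3) closedin_closure_of by metis
qed

text \<open>Countable sum theorem for large inductive dimension zero. Enlarging the pair along an
  enumeration of \<open>\<K>\<close> gives two increasing sequences, whose unions are the required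
  open partition.\<close>

lemma normal_space_separated_between_countable_union:
  fixes X :: "'a topology"
  assumes X: "normal_space X"
    and \<K>: "countable \<K>" "topspace X \<subseteq> \<Union>\<K>" "\<And>K. K \<in> \<K> \<Longrightarrow> closedin X K"
    and sep: "\<And>K S T. K \<in> \<K> \<Longrightarrow> closedin X S \<Longrightarrow> closedin X T \<Longrightarrow> disjnt S T \<Longrightarrow>
                separated_between (subtopology X K) (K \<inter> S) (K \<inter> T)"
    and ST: "closedin X S" "closedin X T" "disjnt S T"
  shows "separated_between X S T"
proof (cases "\<K> = {}")
  case True
  then show ?thesis
    using \<K>(2) closedin_subset[OF ST(1)] closedin_subset[OF ST(2)]
    by (simp add: separated_between_empty)
next
  case False
  \<comment> \<open>The enumeration may repeat members, which covers finite families as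
    well.\<close>
  define k where "k = from_nat_into \<K>"
  have k: "k n \<in> \<K>" for n
    using False by (simp add: k_def from_nat_into)
  have range: "range k = \<K>"
    using False \<K>(1) by (simp add: k_def range_from_nat_into)
  define P where "P = (\<lambda>(A, B). closedin X A \<and> closedin X B \<and> disjnt A B)"
  define Q where "Q = (\<lambda>n (A, B) (A', B').
    A \<subseteq> X interior_of A' \<and> B \<subseteq> X interior_of B' \<and> k n \<subseteq> A' \<union> B')"
  \<comment> \<open>The conjunct for \<open>n = 0\<close> pins the start of the chosen sequence to
    \<open>(S, T)\<close>.\<close>
  have "\<exists>f. \<forall>n. (P (f n) \<and> (n = 0 \<longrightarrow> f n = (S, T))) \<and> Q n (f n) (f (Suc n))"
  proof (rule dependent_nat_choice)
    show "\<exists>x. P x \<and> (0 = 0 \<longrightarrow> x = (S, T))"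
      using ST by (auto simp: P_def)
  next
    fix x and n :: nat assume "P x \<and> (n = 0 \<longrightarrow> x = (S, T))"
    then obtain A B where x: "x = (A, B)" and AB: "closedin X A" "closedin X B" "disjnt A B"
      by (auto simp: P_def)
    obtain A' B' where "closedin X A'" "closedin X B'" "disjnt A' B'"
      "A \<subseteq> X interior_of A'" "B \<subseteq> X interior_of B'" "k n \<subseteq> A' \<union> B'"
      by (rule normal_space_separated_between_enlarge[OF X \<K>(3)[OF k[of n]] _ AB])
        (use sep[OF k[of n]] in blast)+
    then show "\<exists>y. (P y \<and> (Suc n = 0 \<longrightarrow> y = (S, T))) \<and> Q n x y"
      by (intro exI[of _ "(A', B')"]) (auto simp: P_def Q_def x)
  qed
  then obtain f where "\<And>n. (P (f n) \<and> (n = 0 \<longrightarrow> f n = (S, T))) \<and> Q n (f n) (f (Suc n))"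
    by meson
  then have f: "f 0 = (S, T)" "\<And>n. P (f n)" "\<And>n. Q n (f n) (f (Suc n))"
    by simp_all
  define A B where "A = (\<lambda>n. fst (f n))" and "B = (\<lambda>n. snd (f n))"
  have AB0: "A 0 = S" "B 0 = T"
    by (simp_all add: A_def B_def f(1))
  have closed: "closedin X (A n)" "closedin X (B n)" and disj: "disjnt (A n) (B n)" for n
    using f(2)[of n] by (auto simp: P_def A_def B_def split: prod.splits)
  have step: "A n \<subseteq> X interior_of A (Suc n)" "B n \<subseteq> X interior_of B (Suc n)"
    "k n \<subseteq> A (Suc n) \<union> B (Suc n)" for n
    using f(3)[of n] by (auto simp: Q_def A_def B_def split: prod.splits)
  have "A n \<subseteq> A (Suc n)" "B n \<subseteq> B (Suc n)" for n
    using step(1,2)[of n] interior_of_subset[of X] by (meson order_trans)+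
  then have mono: "mono A" "mono B"
    by (simp_all add: incseq_SucI)
  \<comment> \<open>Each closed set lies in the interior of the next, so the union of closed sets is
    a union of open ones.\<close>
  have "(\<Union>n. C n) = (\<Union>n. X interior_of C n)" if "\<And>n. C n \<subseteq> X interior_of C (Suc n)" for C :: "nat \<Rightarrow> 'a set"
  proof
    show "(\<Union>n. C n) \<subseteq> (\<Union>n. X interior_of C n)"
      using that by blast
    show "(\<Union>n. X interior_of C n) \<subseteq> (\<Union>n. C n)"
      by (intro UN_mono subset_refl interior_of_subset)
  qed
  then have "(\<Union>n. A n) = (\<Union>n. X interior_of A n)" "(\<Union>n. B n) = (\<Union>n. X interior_of B n)"
    using step(1,2) by presburger+
  then have op: "openin X (\<Union>n. A n)" "openin X (\<Union>n. B n)"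
    by (metis (no_types, lifting) imageE openin_Union openin_interior_of)+
  have "disjnt (A m) (B n)" for m n
    using disj[of "max m n"] monoD[OF mono(1), of m "max m n"] monoD[OF mono(2), of n "max m n"]
    by (auto simp: disjnt_iff)
  then have "disjnt (\<Union>n. A n) (\<Union>n. B n)"
    by (auto simp: disjnt_iff)
  moreover have "topspace X \<subseteq> (\<Union>n. A n) \<union> (\<Union>n. B n)"
    using \<K>(2) range step(3) by blast
  then have "(\<Union>n. A n) \<union> (\<Union>n. B n) = topspace X"
    using op[THEN openin_subset] by blast
  ultimately show ?thesis
    unfolding separated_between_def using op AB0 by blast
qed

section \<open>Rectifiable spaces and local compactness\<close>

text \<open>The rectification and its inverse both preserve first coordinates, so their second
  coordinates carry all the information. In a topological group one may take \<open>p x y\<close> as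
  the product of \<open>x\<close> and \<open>y\<close>, and \<open>q x y\<close> as the product of
  the inverse of \<open>x\<close> with \<open>y\<close>.\<close>

lemma rectifiable_spaceE:
  assumes "rectifiable_space G"
  obtains p q e where "e \<in> topspace G"
    "continuous_map (prod_topology G G) G (\<lambda>(x, y). p x y)"
    "continuous_map (prod_topology G G) G (\<lambda>(x, y). q x y)"
    "\<And>x y. x \<in> topspace G \<Longrightarrow> y \<in> topspace G \<Longrightarrow> p x (q x y) = y"
    "\<And>x y. x \<in> topspace G \<Longrightarrow> y \<in> topspace G \<Longrightarrow> q x (p x y) = y"
    "\<And>x. x \<in> topspace G \<Longrightarrow> q x x = e"
    "\<And>x. x \<in> topspace G \<Longrightarrow> p x e = x"
proof -
  let ?P = "prod_topology G G"
  obtain \<phi> e where \<phi>: "homeomorphic_map ?P ?P \<phi>" and e: "e \<in> topspace G"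
    and fst\<phi>: "\<And>x y. x \<in> topspace G \<Longrightarrow> y \<in> topspace G \<Longrightarrow> fst (\<phi> (x, y)) = x"
    and diag: "\<And>x. x \<in> topspace G \<Longrightarrow> \<phi> (x, x) = (x, e)"
    using assms unfolding rectifiable_space_def by fastforce
  obtain \<psi> where "homeomorphic_maps ?P ?P \<phi> \<psi>"
    using \<phi> homeomorphic_map_maps by blast
  then have cont: "continuous_map ?P ?P \<phi>" "continuous_map ?P ?P \<psi>"
    and inv: "\<And>z. z \<in> topspace ?P \<Longrightarrow> \<psi> (\<phi> z) = z" "\<And>z. z \<in> topspace ?P \<Longrightarrow> \<phi> (\<psi> z) = z"
    unfolding homeomorphic_maps_def by auto
  have \<psi>: "\<psi> z \<in> topspace ?P" if "z \<in> topspace ?P" for z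
    using cont(2) that continuous_map_image_subset_topspace by blast
  have fst\<psi>: "fst (\<psi> (x, y)) = x" if "x \<in> topspace G" "y \<in> topspace G" for x y
    using fst\<phi>[of "fst (\<psi> (x, y))" "snd (\<psi> (x, y))"] \<psi>[of "(x, y)"] inv(2)[of "(x, y)"] that
    by (auto simp: mem_Times_iff)
  define p q where "p = (\<lambda>x y. snd (\<psi> (x, y)))" and "q = (\<lambda>x y. snd (\<phi> (x, y)))"
  have \<phi>q: "\<phi> (x, y) = (x, q x y)" if "x \<in> topspace G" "y \<in> topspace G" for x y
    using fst\<phi>[OF that] by (simp add: q_def prod_eq_iff)
  have \<psi>p: "\<psi> (x, y) = (x, p x y)" if "x \<in> topspace G" "y \<in> topspace G" for x y
    using fst\<psi>[OF that] by (simp add: p_def prod_eq_iff)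
  show thesis
  proof
    show "e \<in> topspace G"
      by (rule e)
    show "continuous_map ?P G (\<lambda>(x, y). p x y)" "continuous_map ?P G (\<lambda>(x, y). q x y)"
      using continuous_map_compose[OF cont(2) continuous_map_snd]
        continuous_map_compose[OF cont(1) continuous_map_snd]
      by (simp_all add: p_def q_def o_def case_prod_unfold)
    show "p x (q x y) = y" if "x \<in> topspace G" "y \<in> topspace G" for x y
      using inv(1)[of "(x, y)"] \<phi>q[OF that] that by (simp add: p_def)
    show "q x (p x y) = y" if "x \<in> topspace G" "y \<in> topspace G" for x y
      using inv(2)[of "(x, y)"] \<psi>p[OF that] that by (simp add: q_def)
    show "q x x = e" if "x \<in> topspace G" for x
      using diag[OF that] by (simp add: q_def)
    show "p x e = x" if "x \<in> topspace G" for x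
      using inv(1)[of "(x, x)"] diag[OF that] that by (simp add: p_def)
  qed
qed

lemma rectifiable_bc_base_connected_compact_imp_locally_compact:
  assumes H: "Hausdorff_space G" and R: "rectifiable_space G" and bc: "bc_base G \<B>"
    and K: "compactin G K" "connectedin G K" "a \<in> K" "b \<in> K" "a \<noteq> b"
  shows "locally_compact_space G"
proof -
  obtain p q e where e: "e \<in> topspace G"
    and contp: "continuous_map (prod_topology G G) G (\<lambda>(x, y). p x y)"
    and contq: "continuous_map (prod_topology G G) G (\<lambda>(x, y). q x y)"
    and pq: "\<And>x y. x \<in> topspace G \<Longrightarrow> y \<in> topspace G \<Longrightarrow> p x (q x y) = y"
    and qp: "\<And>x y. x \<in> topspace G \<Longrightarrow> y \<in> topspace G \<Longrightarrow> q x (p x y) = y"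
    and qe: "\<And>x. x \<in> topspace G \<Longrightarrow> q x x = e"
    and pe: "\<And>x. x \<in> topspace G \<Longrightarrow> p x e = x"
    using R by (rule rectifiable_spaceE) blast
  have cts: "continuous_map G G (p x)" "continuous_map G G (q x)" 
      "continuous_map G G (\<lambda>y. p y x)" if "x \<in> topspace G" for x
  proof -
    have x1: "continuous_map G (prod_topology G G) (\<lambda>y. (x, y))"
     and x2: "continuous_map G (prod_topology G G) (\<lambda>y. (y, x))"
      using that by (simp_all add: continuous_map_pairedI)
    show "continuous_map G G (p x)" "continuous_map G G (q x)" "continuous_map G G (\<lambda>y. p y x)"
      using continuous_map_compose[OF x1 contp] continuous_map_compose[OF x1 contq]
        continuous_map_compose[OF x2 contp] by (simp_all add: o_def)
  qed
  have Ksub: "K \<subseteq> topspace G"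
    using K(1) compactin_subset_topspace by blast
  then have ab: "a \<in> topspace G" "b \<in> topspace G"
    using K by auto
  then obtain U0 V0 where UV0: "openin G U0" "openin G V0" "a \<in> U0" "b \<in> V0" "disjnt U0 V0"
    using H K(5) unfolding Hausdorff_space_def by metis
  then obtain U where U: "U \<in> \<B>" "a \<in> U" "U \<subseteq> U0"
    using bc unfolding bc_base_def open_base_def by metis
  have oU: "openin G U" and cB: "compactin G (G closure_of U - U)"
    using bc U(1) unfolding bc_base_def open_base_def by auto
  \<comment> \<open>This places \<open>b\<close> in the open exterior of \<open>U\<close>, so that
    the condition on \<open>p b z\<close> in \<open>W\<close> is an open one.\<close>
  have "disjnt (G closure_of U) V0"
    using UV0 U(3) openin_Int_closure_of_eq_empty[of G V0 U] by (auto simp: disjnt_iff)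
  then have b: "b \<notin> G closure_of U"
    using UV0(4) by (auto simp: disjnt_iff)
  \<comment> \<open>\<open>W\<close> is the neighbourhood of \<open>e\<close> on which
    \<open>p a z\<close> stays in \<open>U\<close> and \<open>p b z\<close> stays in the exterior;
    \<open>e\<close> belongs to it because \<open>p a e = a\<close> and \<open>p b e = b\<close>.
    The compact set \<open>C\<close> will contain it.\<close>
  define W where "W = {z \<in> topspace G. p a z \<in> U} \<inter> {z \<in> topspace G. p b z \<in> topspace G - G closure_of U}"
  define C where "C = (\<lambda>(x, y). q x y) ` (K \<times> (G closure_of U - U))"
  have oW: "openin G W"
    unfolding W_def using cts(1)[OF ab(1)] cts(1)[OF ab(2)] oU
    by (intro openin_Int openin_continuous_map_preimage) auto
  have eW: "e \<in> W"
    using e pe ab U(2) b by (auto simp: W_def)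
  have cC: "compactin G C"
    unfolding C_def using contq K(1) cB by (intro image_compactin) (auto simp: compactin_Times)
  have WC: "W \<subseteq> C"
  proof
    fix z assume z: "z \<in> W"
    then have zG: "z \<in> topspace G"
      by (auto simp: W_def)
    have "connectedin G ((\<lambda>k. p k z) ` K)"
      using connectedin_continuous_map_image[OF cts(3)[OF zG] K(2)] .
    moreover have "p a z \<in> (\<lambda>k. p k z) ` K \<inter> U" "p b z \<in> (\<lambda>k. p k z) ` K - U"
      using z K closure_of_subset[OF openin_subset[OF oU]] by (auto simp: W_def)
    ultimately have "(\<lambda>k. p k z) ` K \<inter> G frontier_of U \<noteq> {}"
      by (intro connectedin_Int_frontier_of) auto
    then obtain k where k: "k \<in> K" "p k z \<in> G closure_of U - U"
      using oU by (auto simp: frontier_of_openin)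
    then have "z = q k (p k z)"
      using qp Ksub zG by auto
    with k show "z \<in> C"
      unfolding C_def by force
  qed
  show ?thesis
    unfolding locally_compact_space_def
  proof
    \<comment> \<open>Homogeneity: \<open>q g\<close> sends \<open>g\<close> to \<open>e\<close> and
      has the continuous inverse \<open>p g\<close>, so \<open>W\<close> and \<open>C\<close> are
      pulled back to a neighbourhood of \<open>g\<close> and a compact set containing it.\<close>
    fix g assume g: "g \<in> topspace G"
    let ?V = "{x \<in> topspace G. q g x \<in> W}"
    have "openin G ?V"
      using cts(2)[OF g] oW by (rule openin_continuous_map_preimage)
    moreover have "compactin G (p g ` C)"
      using cts(1)[OF g] cC image_compactin by blast
    moreover have "g \<in> ?V"
      using g qe eW by simp
    moreover have "?V \<subseteq> p g ` C"
      using pq[OF g] WC by force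
    ultimately show "\<exists>U K. openin G U \<and> compactin G K \<and> g \<in> U \<and> U \<subseteq> K"
      by blast
  qed
qed

section \<open>Sigma-compact sets with totally disconnected compact subsets\<close>

lemma sigma_compactin_imp_Lindelof_space:
  assumes "sigma_compactin X S"
  shows "Lindelof_space (subtopology X S)"
proof -
  obtain \<K> where "countable \<K>" "\<And>K. K \<in> \<K> \<Longrightarrow> compactin X K" "S = \<Union>\<K>"
    using assms unfolding sigma_compactin_def by blast
  then show ?thesis
    using Lindelof_space_Union[of \<K> X]
    by (simp add: compact_imp_Lindelof_space compactin_subspace)
qed

lemma sigma_compactin_closed_subset:
  assumes "sigma_compactin X S" "closedin X F" "F \<subseteq> S"
  shows "sigma_compactin X F"
proof -
  obtain \<K> where \<K>: "countable \<K>" "\<And>K. K \<in> \<K> \<Longrightarrow> compactin X K" "S = \<Union>\<K>"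
    using assms unfolding sigma_compactin_def by blast
  have "compactin X (F \<inter> K)" if "K \<in> \<K>" for K
    using \<K>(2)[OF that] assms(2) closed_Int_compactin by blast
  then show ?thesis
    unfolding sigma_compactin_def
    using \<K> assms(3) by (intro exI[of _ "(\<lambda>K. F \<inter> K) ` \<K>"]) auto
qed

text \<open>\<open>F\<close> is regular and Lindelof, hence normal, and is a countable union of
  closed compact pieces, on each of which the compact case applies. The sum theorem then assembles
  the pieces.\<close>

lemma sigma_compactin_totally_disconnected_separated_between:
  assumes H: "Hausdorff_space X" and reg: "regular_space X" and F: "sigma_compactin X F"
    and td: "\<And>K a b. compactin X K \<Longrightarrow> connectedin X K \<Longrightarrow> a \<in> K \<Longrightarrow> b \<in> K \<Longrightarrow> a = b"
    and ST: "closedin (subtopology X F) S" "closedin (subtopology X F) T" "disjnt S T"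
  shows "separated_between (subtopology X F) S T"
proof -
  obtain \<K> where \<K>: "countable \<K>" "\<And>K. K \<in> \<K> \<Longrightarrow> compactin X K" "F = \<Union>\<K>"
    using F unfolding sigma_compactin_def by blast
  have "normal_space (subtopology X F)"
    using F reg by (simp add: regular_Lindelof_imp_normal_space regular_space_subtopology
        sigma_compactin_imp_Lindelof_space)
  moreover have "closedin (subtopology X F) K" if "K \<in> \<K>" for K
    using \<K>(2)[OF that] \<K>(3) that H
    by (metis Union_upper closedin_subset_topspace compactin_imp_closedin)
  moreover have "separated_between (subtopology (subtopology X F) K) (K \<inter> S') (K \<inter> T')"
    if K: "K \<in> \<K>" and "closedin (subtopology X F) S'" "closedin (subtopology X F) T'" "disjnt S' T'"
    for K S' T'
  proof -
    have KF: "F \<inter> K = K"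
      using K \<K>(3) by blast
    have cK: "compactin X K"
      using \<K>(2)[OF K] .
    show ?thesis
      unfolding subtopology_subtopology KF
    proof (rule separated_between_compact_totally_disconnected)
      show "compact_space (subtopology X K)" "Hausdorff_space (subtopology X K)"
        using cK H by (auto simp: compactin_subspace Hausdorff_space_subtopology)
      show "closedin (subtopology X K) (K \<inter> S')" "closedin (subtopology X K) (K \<inter> T')"
        using that(2,3) KF unfolding closedin_subtopology by blast+
      show "disjnt (K \<inter> S') (K \<inter> T')"
        using that(4) by (auto simp: disjnt_iff)
      fix C a b assume C: "connectedin (subtopology X K) C" and ab: "a \<in> C" "b \<in> C"
      \<comment> \<open>\<open>td\<close> speaks of compact connected sets, while \<open>C\<close>
        is only connected; its closure in the compact \<open>K\<close> is both.\<close>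
      let ?D = "subtopology X K closure_of C"
      have "connectedin (subtopology X K) ?D"
        using C connectedin_closure_of by blast
      moreover have "compactin (subtopology X K) ?D"
        using cK by (intro closedin_compact_space) (auto simp: compactin_subspace)
      moreover have "C \<subseteq> ?D"
        using C by (intro closure_of_subset connectedin_subset_topspace)
      ultimately show "a = b"
        using td[of ?D a b] ab by (auto simp: connectedin_subtopology compactin_subtopology)
    qed
  qed
  ultimately show ?thesis
    using \<K>(1,3) ST
    by (intro normal_space_separated_between_countable_union[of "subtopology X F" \<K> S T]) simp_all
qed

theorem corollary3p6:
  fixes G :: "'a topology"
  assumes "Hausdorff_space G"
    and "rectifiable_space G"
    and "locally_sigma_compact_space G"
    and "\<exists>\<B>. bc_base G \<B>"
  shows "locally_compact_space G \<or> zero_dimensional_space G"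
proof (cases "locally_compact_space G")
  case True
  then show ?thesis ..
next
  case nlc: False
  obtain \<B> where bc: "bc_base G \<B>"
    using assms(4) by blast
  have td: "a = b" if "compactin G K" "connectedin G K" "a \<in> K" "b \<in> K" for K a b
    using rectifiable_bc_base_connected_compact_imp_locally_compact[OF assms(1,2) bc that] nlc
    by blast
  \<comment> \<open>A clopen neighbourhood of \<open>x\<close> is cut out of the closure of a small
    base member \<open>U\<close> by separating \<open>x\<close> from the boundary of
    \<open>U\<close>.\<close>
  have "\<exists>A. openin G A \<and> closedin G A \<and> x \<in> A \<and> A \<subseteq> O'" if O': "openin G O'" "x \<in> O'" for O' x
  proof -
    obtain N where N: "x \<in> G interior_of N" "sigma_compactin G (G closure_of N)"
      using assms(3) O' openin_subset unfolding locally_sigma_compact_space_def by blast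
    have "openin G (O' \<inter> G interior_of N)" "x \<in> O' \<inter> G interior_of N"
      using O' N(1) by auto
    then obtain U where U: "U \<in> \<B>" "x \<in> U" "U \<subseteq> O' \<inter> G interior_of N"
      using bc unfolding bc_base_def open_base_def by metis
    have oU: "openin G U"
      using bc U(1) unfolding bc_base_def open_base_def by auto
    let ?F = "G closure_of U"
    have UF: "U \<subseteq> ?F"
      using oU by (simp add: closure_of_subset openin_subset)
    have "U \<subseteq> N"
      using U(3) interior_of_subset by fast
    then have F: "sigma_compactin G ?F"
      using sigma_compactin_closed_subset[OF N(2)] by (simp add: closure_of_mono)
    have "x \<in> topspace G"
      using U(2) oU openin_subset by blast
    then have "closedin (subtopology G ?F) {x}"
      using assms(1) U(2) UF by (intro closedin_subset_topspace closedin_Hausdorff_singleton) auto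
    moreover have "closedin (subtopology G ?F) (?F - U)"
      using oU by (simp add: closedin_diff closedin_subset_topspace)
    ultimately have "separated_between (subtopology G ?F) {x} (?F - U)"
      using U(2) bc_base_imp_regular_space[OF assms(1) bc]
      by (intro sigma_compactin_totally_disconnected_separated_between[OF assms(1) _ F td]) auto
    then obtain A B where AB: "openin (subtopology G ?F) A" "openin (subtopology G ?F) B"
      "A \<union> B = ?F" "disjnt A B" "x \<in> A" "?F - U \<subseteq> B"
      unfolding separated_between_def
      using closure_of_subset_topspace[of G U] by (auto simp: Int_absorb1)
    have "A = ?F - B"
      using AB(3,4) by (auto simp: disjnt_iff)
    moreover have "closedin (subtopology G ?F) (?F - B)"
      using AB(2) closure_of_subset_topspace[of G U]
      by (metis Int_absorb1 closedin_diff closedin_topspace topspace_subtopology)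
    \<comment> \<open>Relative closedness in \<open>?F\<close> passes to \<open>G\<close> because
      \<open>?F\<close> is closed.\<close>
    ultimately have "closedin G A"
      using closedin_closure_of closedin_trans_full by metis
    moreover have AU: "A \<subseteq> U"
      using AB(3,4,6) by (auto simp: disjnt_iff)
    \<comment> \<open>Since \<open>A\<close> avoids the boundary and lies in the open set
      \<open>U\<close>, intersecting \<open>V\<close> with \<open>U\<close> instead of
      \<open>?F\<close> gives the same set, so \<open>A\<close> is open in \<open>G\<close>.\<close>
    obtain V where "openin G V" "A = V \<inter> ?F"
      using AB(1) unfolding openin_subtopology by blast
    then have "A = V \<inter> U"
      using AU UF by blast
    then have "openin G A"
      using \<open>openin G V\<close> oU by blast
    ultimately show ?thesis
      using AB(5) AU U(3) by blast
  qed
  then have "zero_dimensional_space G"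
    unfolding zero_dimensional_space_def open_base_def
    by (intro exI[of _ "{A. openin G A \<and> closedin G A}"]) blast
  then show ?thesis ..
qed

end
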